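(* For every integer $n>10$, $g\big[\mathbf{CP}_n(\mathbb{R})\big]\ge 1.0045\,n$. Moreover, $\limsup_{n\to\infty} g\big[\mathbf{CP}_n(\mathbb{R})\big]/n \ge 3.317$.
   Context: For an $n\times n$ complex matrix $A=(a_{i,j})$, Gaussian elimination without pivoting is the recursion $a^{(1)}_{i,j}=a_{i,j}$ ($1\le i,j\le n$) and $a^{(k+1)}_{i,j}=a^{(k)}_{i,j}-a^{(k)}_{i,k}a^{(k)}_{k,j}/a^{(k)}_{k,k}$ for $k+1\le i,j\le n$, $k=1,\dots,n-1$, which is defined when all pivots $a^{(k)}_{k,k}$ are nonzero. The growth factor is $g(A)=\max_{i,j,k}|a^{(k)}_{i,j}|/\max_{i,j}|a_{i,j}|$. For $S\subseteq\mathbb{C}$, $\mathbf{CP}_n(S)$ (completely pivoted matrices) is the set of invertible $A\in S^{n\times n}$ for which Gaussian elimination without pivoting is defined and $|a^{(k)}_{i,j}|\le|a^{(k)}_{k,k}|$ for all $k$ and all $i,j\ge k$. For a set $\mathbf{X}$ of matrices, $g[\mathbf{X}]=\sup_{A\in\mathbf{X}}g(A)$. (The result is established with computer-assisted, exactly verified examples.) *)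

theory Defs
  imports Complex_Main "Jordan_Normal_Form.Matrix" "HOL-Library.Extended_Real"
    "HOL-Library.Liminf_Limsup"
begin

text \<open>Gaussian elimination without pivoting, 0-based indices.
  ge A k corresponds to the paper's a^(k+1); it is meaningful for k <= i, j < n.\<close>
fun ge :: "complex mat \<Rightarrow> nat \<Rightarrow> nat \<Rightarrow> nat \<Rightarrow> complex" where
  "ge A 0 i j = A $$ (i, j)"
| "ge A (Suc k) i j = ge A k i j - ge A k i k * ge A k k j / ge A k k k"

definition ge_defined :: "nat \<Rightarrow> complex mat \<Rightarrow> bool" where
  "ge_defined n A \<longleftrightarrow> (\<forall>k. k + 1 < n \<longrightarrow> ge A k k k \<noteq> 0)"

definition growth :: "nat \<Rightarrow> complex mat \<Rightarrow> real" where
  "growth n A =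
     Max {cmod (ge A k i j) | k i j. k \<le> i \<and> i < n \<and> k \<le> j \<and> j < n}
     / Max {cmod (A $$ (i, j)) | i j. i < n \<and> j < n}"

definition CP :: "nat \<Rightarrow> complex set \<Rightarrow> complex mat set" where
  "CP n S = {A. A \<in> carrier_mat n n \<and> (\<forall>i<n. \<forall>j<n. A $$ (i, j) \<in> S)
      \<and> invertible_mat A \<and> ge_defined n A
      \<and> (\<forall>k<n. \<forall>i j. k \<le> i \<and> i < n \<and> k \<le> j \<and> j < n
              \<longrightarrow> cmod (ge A k i j) \<le> cmod (ge A k k k))}"

text \<open>g[X] as an extended real supremum (so unboundedness is not an issue).\<close>
definition gsup :: "nat \<Rightarrow> complex mat set \<Rightarrow> ereal" where
  "gsup n X = (SUP A\<in>X. ereal (growth n A))"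

end

(*  Kronecker products. If A is completely pivoted and B has pivots b_l and elimination stages B_l
    (extended by zero) with |B_l| <= b_l and |2 B_0 - B_l| <= b_l, then A (x) B is completely pivoted:
    every entry that occurs during its elimination has the form a B_0 - c (B_0 - B_l) with |a|, |c|
    at most the current pivot of A, so it is at most that pivot times b_l. Growth factors therefore
    multiply. The 2x2 Hadamard matrix is such a B, so growth at least 1.0045 (n + 1) propagates from
    14 <= n < 28 to all n >= 14. There is also a 16x16 such B with growth above 17; its Kronecker
    powers make the growth factor superlinear, and the limsup is in fact infinite.

    The matrices were found by numerical optimization. Each is given by an integer factorization
    W U, for which the k-th elimination stage is a tail sum of the products and needs no division. *)

theory Submission
  imports Defs "Jordan_Normal_Form.Determinant"
begin

section \<open>Eliminations with complete pivoting\<close>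

text \<open>The stages are data constrained by the recursion, not values computed from a matrix, so
  that they can be given in closed form. The recursion is also imposed on row and column
  \<open>k\<close>, where it yields 0 at stage \<open>Suc k\<close>. Pivots are normalized to be
  positive, so that \<open>R k k k\<close> is itself the bound for stage \<open>k\<close>.\<close>

definition pivot_run :: "nat \<Rightarrow> (nat \<Rightarrow> nat \<Rightarrow> nat \<Rightarrow> real) \<Rightarrow> bool" where
  "pivot_run n R \<longleftrightarrow> (\<forall>k<n. 0 < R k k k \<and> (\<forall>i j. k \<le> i \<and> i < n \<and> k \<le> j \<and> j < n \<longrightarrow>
      \<bar>R k i j\<bar> \<le> R k k k \<and> R (Suc k) i j = R k i j - R k i k * R k k j / R k k k))"

text \<open>With complete pivoting \<open>R 0 0 0\<close> is the largest entry of the matrix, so the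
  ratio of the last to the first pivot bounds the growth factor from below. This ratio is what
  multiplies under Kronecker products.\<close>

definition grows :: "nat \<Rightarrow> real \<Rightarrow> bool" where
  "grows n g \<longleftrightarrow> (\<exists>R. pivot_run n R \<and> g * R 0 0 0 \<le> R (n - 1) (n - 1) (n - 1))"

lemma pivot_runD:
  assumes "pivot_run n R" "k < n"
  shows "0 < R k k k"
    and "k \<le> i \<Longrightarrow> i < n \<Longrightarrow> k \<le> j \<Longrightarrow> j < n \<Longrightarrow> \<bar>R k i j\<bar> \<le> R k k k"
    and "k \<le> i \<Longrightarrow> i < n \<Longrightarrow> k \<le> j \<Longrightarrow> j < n \<Longrightarrow>
           R (Suc k) i j = R k i j - R k i k * R k k j / R k k k"
  using assms unfolding pivot_run_def by auto

section \<open>From real runs to matrices in \<open>CP n \<real>\<close>\<close>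

definition run_mat :: "nat \<Rightarrow> (nat \<Rightarrow> nat \<Rightarrow> nat \<Rightarrow> real) \<Rightarrow> complex mat" where
  "run_mat n R = mat n n (\<lambda>(i, j). complex_of_real (R 0 i j))"

lemma ge_run_mat:
  assumes "pivot_run n R" "k \<le> i" "i < n" "k \<le> j" "j < n"
  shows "ge (run_mat n R) k i j = of_real (R k i j)"
  using assms(2-)
proof (induction k arbitrary: i j)
  case 0
  then show ?case by (simp add: run_mat_def)
next
  case (Suc k)
  then show ?case
    using pivot_runD(3)[OF assms(1), of k i j] by (simp add: Suc.IH)
qed

text \<open>A kernel vector solves the remaining equations of every stage, since stages arise by row
  operations. Back substitution from the last coordinate then makes it zero.\<close>

lemma run_mat_invertible:
  assumes run: "pivot_run n R"
  shows "invertible_mat (run_mat n R)"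
proof -
  let ?A = "run_mat n R"
  have A: "?A \<in> carrier_mat n n" by (simp add: run_mat_def)
  have "det ?A \<noteq> 0"
  proof
    assume "det ?A = 0"
    then obtain v where v: "v \<in> carrier_vec n" "v \<noteq> 0\<^sub>v n" "?A *\<^sub>v v = 0\<^sub>v n"
      using det_0_iff_vec_prod_zero[OF A] by auto
    have sys: "(\<Sum>j=k..<n. of_real (R k i j) * v $ j) = 0" if "k \<le> i" "i < n" for k i
      using that
    proof (induction k arbitrary: i)
      case 0
      have "(?A *\<^sub>v v) $ i = 0" using v(3) 0 by simp
      then show ?case
        using v(1) 0 by (simp add: run_mat_def scalar_prod_def row_def)
    next
      case (Suc k)
      note p = pivot_runD[OF run, of k]
      have split: "(\<Sum>j=k..<n. f j) = f k + (\<Sum>j=Suc k..<n. f j)" for f :: "nat \<Rightarrow> complex"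
        using Suc.prems by (simp add: sum.atLeast_Suc_lessThan)
      let ?q = "complex_of_real (R k i k / R k k k)"
      have "(\<Sum>j=Suc k..<n. of_real (R (Suc k) i j) * v $ j)
          = (\<Sum>j=Suc k..<n. of_real (R k i j) * v $ j - ?q * (of_real (R k k j) * v $ j))"
        using Suc.prems p(3) by (intro sum.cong) (auto simp: left_diff_distrib)
      also have "\<dots> = (\<Sum>j=Suc k..<n. of_real (R k i j) * v $ j)
          - ?q * (\<Sum>j=Suc k..<n. of_real (R k k j) * v $ j)"
        by (simp only: sum_subtractf sum_distrib_left)
      also have "\<dots> = (\<Sum>j=k..<n. of_real (R k i j) * v $ j)
          - ?q * (\<Sum>j=k..<n. of_real (R k k j) * v $ j)"
      proof -
        \<comment> \<open>The terms at \<open>j = k\<close> cancel, so both sums may start at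
          \<open>k\<close>, where the induction hypothesis applies.\<close>
        have "?q * (of_real (R k k k) * v $ k) = of_real (R k i k) * v $ k"
          using p(1) Suc.prems by simp
        then show ?thesis unfolding split by (simp only: distrib_left) simp
      qed
      also have "\<dots> = 0"
        using Suc by simp
      finally show ?case .
    qed
    have "v $ k = 0" if "k < n" for k
      using that
    proof (induction "n - k" arbitrary: k rule: less_induct)
      case less
      \<comment> \<open>In row \<open>k\<close> of stage \<open>k\<close> all later coordinates of
        \<open>v\<close> vanish by induction.\<close>
      have "(\<Sum>j=k..<n. of_real (R k k j) * v $ j) = of_real (R k k k) * v $ k"
        using less by (subst sum.atLeast_Suc_lessThan) (auto intro!: sum.neutral)
      with sys[of k k] pivot_runD(1)[OF run less.prems] less.prems show ?case by simp
    qed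
    with v show False by (auto simp: vec_eq_iff)
  qed
  then have "?A \<in> Units (ring_mat TYPE(complex) n ())"
    by (rule det_non_zero_imp_unit[OF A])
  then show ?thesis
    unfolding Units_def invertible_mat_def inverts_mat_def
    by (auto simp: ring_mat_simps run_mat_def)
qed

lemma run_mat_CP:
  assumes run: "pivot_run n R"
  shows "run_mat n R \<in> CP n \<real>"
proof -
  have "ge_defined n (run_mat n R)"
    unfolding ge_defined_def using ge_run_mat[OF run] pivot_runD(1)[OF run]
    by (auto simp: less_le)
  then show ?thesis
    using run_mat_invertible[OF run] ge_run_mat[OF run] pivot_runD(1,2)[OF run]
    by (auto simp: CP_def run_mat_def abs_of_pos)
qed

text \<open>The last pivot is among the values in the maximum of the numerator, and complete
  pivoting at stage 0 makes \<open>R 0 0 0\<close> the denominator.\<close>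

lemma grows_le_gsup:
  assumes "grows n g" "0 < n"
  shows "ereal g \<le> gsup n (CP n \<real>)"
proof -
  obtain R where run: "pivot_run n R" and g: "g * R 0 0 0 \<le> R (n - 1) (n - 1) (n - 1)"
    using assms(1) by (auto simp: grows_def)
  note p = pivot_runD[OF run]
  let ?A = "run_mat n R"
  let ?M = "{cmod (ge ?A k i j) | k i j. k \<le> i \<and> i < n \<and> k \<le> j \<and> j < n}"
  let ?N = "{cmod (?A $$ (i, j)) | i j. i < n \<and> j < n}"
  have fin: "finite ?M"
  proof (rule finite_subset)
    show "?M \<subseteq> (\<Union>k\<in>{..<n}. \<Union>i\<in>{..<n}. \<Union>j\<in>{..<n}. {cmod (ge ?A k i j)})"
      using le_less_trans by blast
  qed simp
  have finN: "finite ?N"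
    by (rule finite_subset[of _ "(\<lambda>(i, j). cmod (?A $$ (i, j))) ` ({..<n} \<times> {..<n})"]) auto
  have "n - 1 < n" using assms(2) by simp
  then have "cmod (ge ?A (n - 1) (n - 1) (n - 1)) \<in> ?M" by blast
  then have "cmod (ge ?A (n - 1) (n - 1) (n - 1)) \<le> Max ?M"
    by (rule Max_ge[OF fin])
  then have M: "R (n - 1) (n - 1) (n - 1) \<le> Max ?M"
    using ge_run_mat[OF run, of "n - 1" "n - 1" "n - 1"] assms(2) by simp
  have N: "Max ?N = R 0 0 0"
  proof (rule Max_eqI[OF finN])
    show "y \<le> R 0 0 0" if "y \<in> ?N" for y
      using that p(2)[of 0] assms(2) by (auto simp: run_mat_def)
    show "R 0 0 0 \<in> ?N"
      using p(1)[of 0] assms(2) by (force simp: run_mat_def)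
  qed
  have "g \<le> Max ?M / Max ?N"
    unfolding N using g M p(1)[of 0] assms(2) by (simp add: field_simps)
  then have "ereal g \<le> ereal (growth n ?A)"
    by (simp add: growth_def)
  also have "\<dots> \<le> gsup n (CP n \<real>)"
    unfolding gsup_def by (intro SUP_upper run_mat_CP run)
  finally show ?thesis .
qed

text \<open>A 1x1 block \<open>R 0 0 0\<close> is adjoined in front of the matrix. It ties with the
  largest entry, hence is an admissible first pivot; eliminating with it changes nothing else, and
  the ratio of last to first pivot is kept.\<close>

lemma grows_Suc:
  assumes "grows n g" "0 < n"
  shows "grows (Suc n) g"
proof -
  obtain R where run: "pivot_run n R" and g: "g * R 0 0 0 \<le> R (n - 1) (n - 1) (n - 1)"
    using assms(1) by (auto simp: grows_def)
  note p = pivot_runD[OF run]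
  \<comment> \<open>Stage \<open>k\<close> shows the old stage \<open>k - 1\<close>. At
    \<open>k = 0\<close> truncated subtraction gives the old stage 0, so stages 0 and 1 agree
    outside the new block.\<close>
  define T where "T k i j = (if i = 0 \<or> j = 0 then if k = 0 \<and> i = j then R 0 0 0 else 0
    else R (k - 1) (i - 1) (j - 1))" for k i j
  have "0 < T k k k \<and> (\<forall>i j. k \<le> i \<and> i < Suc n \<and> k \<le> j \<and> j < Suc n \<longrightarrow>
      \<bar>T k i j\<bar> \<le> T k k k \<and> T (Suc k) i j = T k i j - T k i k * T k k j / T k k k)" if "k < Suc n" for k
  proof (cases k)
    case 0
    then show ?thesis
      using p(1,2)[of 0] assms(2) by (auto simp: T_def abs_of_pos)
  next
    case (Suc k')
    then show ?thesis
      using that p[of k'] by (auto simp: T_def)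
  qed
  then have "pivot_run (Suc n) T"
    by (auto simp: pivot_run_def)
  moreover have "g * T 0 0 0 \<le> T n n n"
    using g assms(2) by (simp add: T_def)
  ultimately show ?thesis
    by (auto simp: grows_def)
qed

lemma grows_mono:
  assumes "grows n g" "0 < n" "n \<le> m" "g' \<le> g"
  shows "grows m g'"
proof -
  have "grows m g"
    using assms(3) by (induction m rule: dec_induct) (use assms in \<open>auto intro: grows_Suc\<close>)
  then obtain R where R: "pivot_run m R" "g * R 0 0 0 \<le> R (m - 1) (m - 1) (m - 1)"
    by (auto simp: grows_def)
  have "g' * R 0 0 0 \<le> g * R 0 0 0"
    using pivot_runD(1)[OF R(1), of 0] assms by (intro mult_right_mono) auto
  with R show ?thesis
    unfolding grows_def by (meson order_trans)
qed

section \<open>Kronecker products\<close>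

text \<open>The bounds and the recursion range over all \<open>i, j < m\<close>, which forces stages
  extended by zero, because later blocks of a Kronecker product meet the pivot block at every
  residue. Where the extended stage is zero, the second bound reads
  \<open>2 * \<bar>S 0 i j\<bar> \<le> S l l l\<close>.\<close>

definition strong_run :: "nat \<Rightarrow> (nat \<Rightarrow> nat \<Rightarrow> nat \<Rightarrow> real) \<Rightarrow> bool" where
  "strong_run m S \<longleftrightarrow> (\<forall>l<m. 0 < S l l l \<and> (\<forall>i<m. \<forall>j<m.
      \<bar>S l i j\<bar> \<le> S l l l \<and> \<bar>2 * S 0 i j - S l i j\<bar> \<le> S l l l
      \<and> S (Suc l) i j = S l i j - S l i l * S l l j / S l l l))
    \<and> (\<forall>i<m. \<forall>j<m. S m i j = 0)"

definition strongly_grows :: "nat \<Rightarrow> real \<Rightarrow> bool" where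
  "strongly_grows m h \<longleftrightarrow> (\<exists>S. strong_run m S \<and> h * S 0 0 0 \<le> S (m - 1) (m - 1) (m - 1))"

lemma strong_runD:
  assumes "strong_run m S" "l < m"
  shows "0 < S l l l"
    and "i < m \<Longrightarrow> j < m \<Longrightarrow> \<bar>S l i j\<bar> \<le> S l l l"
    and "i < m \<Longrightarrow> j < m \<Longrightarrow> \<bar>2 * S 0 i j - S l i j\<bar> \<le> S l l l"
    and "i < m \<Longrightarrow> j < m \<Longrightarrow> S (Suc l) i j = S l i j - S l i l * S l l j / S l l l"
    and "i < m \<Longrightarrow> j < m \<Longrightarrow> S m i j = 0"
  using assms unfolding strong_run_def by auto

lemma strongly_grows_imp_grows: "strongly_grows m h \<Longrightarrow> grows m h"
  unfolding strongly_grows_def grows_def pivot_run_def strong_run_def by blast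

text \<open>In terms of \<open>y\<close> and \<open>2 * x - y\<close> the coefficients are
  \<open>(a + c) / 2\<close> and \<open>(a - c) / 2\<close>, whose absolute values add up to the
  larger of \<open>\<bar>a\<bar>\<close> and \<open>\<bar>c\<bar>\<close>.\<close>

lemma combination_bound:
  fixes a c x y s P :: real
  assumes "\<bar>a\<bar> \<le> P" "\<bar>c\<bar> \<le> P" "\<bar>y\<bar> \<le> s" "\<bar>2 * x - y\<bar> \<le> s"
  shows "\<bar>a * x - c * (x - y)\<bar> \<le> P * s"
proof -
  have s: "0 \<le> s" using assms by linarith
  have "a * x - c * (x - y) = (a + c) / 2 * y + (a - c) / 2 * (2 * x - y)"
    by (simp add: field_simps)
  also have "\<bar>\<dots>\<bar> \<le> \<bar>(a + c) / 2\<bar> * \<bar>y\<bar> + \<bar>(a - c) / 2\<bar> * \<bar>2 * x - y\<bar>"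
    by (metis abs_mult abs_triangle_ineq)
  also have "\<dots> \<le> \<bar>(a + c) / 2\<bar> * s + \<bar>(a - c) / 2\<bar> * s"
    using assms by (intro add_mono mult_left_mono) auto
  also have "\<dots> = (\<bar>(a + c) / 2\<bar> + \<bar>(a - c) / 2\<bar>) * s"
    by (simp add: algebra_simps)
  also have "\<dots> \<le> P * s"
    using assms s by (intro mult_right_mono) (auto simp: abs_if field_simps split: if_splits)
  finally show ?thesis .
qed

text \<open>Step \<open>q = k * m + l\<close> of the product eliminates with row \<open>l\<close> of
  the second factor inside block \<open>k\<close> of the first. \<open>combination_bound\<close>
  gives the pivot bound at each such step.\<close>

lemma grows_times:
  assumes "grows n g" "strongly_grows m h" "0 < n" "0 < m" "0 \<le> g" "0 \<le> h"
  shows "grows (n * m) (g * h)"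
proof -
  obtain R where run: "pivot_run n R" and g: "g * R 0 0 0 \<le> R (n - 1) (n - 1) (n - 1)"
    using assms(1) by (auto simp: grows_def)
  obtain S where srun: "strong_run m S" and h: "h * S 0 0 0 \<le> S (m - 1) (m - 1) (m - 1)"
    using assms(2) by (auto simp: strongly_grows_def)
  note p = pivot_runD[OF run] and s = strong_runD[OF srun]
  \<comment> \<open>This is what step \<open>k\<close> of the first elimination subtracts from an
    entry.\<close>
  define c where "c k i j = R k i k * R k k j / R k k k" for k i j
  \<comment> \<open>The stage reached after \<open>l\<close> steps inside block \<open>k\<close>;
    for \<open>l = 0\<close> it is the Kronecker product of stage \<open>k\<close> of
    \<open>R\<close> with \<open>S 0\<close>.\<close>
  define U where "U k l i j = R k (i div m) (j div m) * S 0 (i mod m) (j mod m)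
     - c k (i div m) (j div m) * (S 0 (i mod m) (j mod m) - S l (i mod m) (j mod m))" for k l i j
  define T where "T q = U (q div m) (q mod m)" for q
  have "0 < T q q q \<and> (\<forall>i j. q \<le> i \<and> i < n * m \<and> q \<le> j \<and> j < n * m \<longrightarrow>
      \<bar>T q i j\<bar> \<le> T q q q \<and> T (Suc q) i j = T q i j - T q i q * T q q j / T q q q)"
    if q: "q < n * m" for q
  proof -
    define k l where "k = q div m" and "l = q mod m"
    have l: "l < m" using assms(4) by (simp add: l_def)
    have k: "k < n" using q by (simp add: k_def less_mult_imp_div_less)
    have P: "0 < R k k k" "0 < S l l l" using p(1)[OF k] s(1)[OF l] by auto
    have Tq: "T q i j = U k l i j" for i j by (simp add: T_def k_def l_def)
    \<comment> \<open>In the pivot block \<open>c\<close> equals \<open>R k k k\<close>, so the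
      \<open>S 0\<close> terms cancel.\<close>
    have Tqq: "T q q q = R k k k * S l l l"
      using P unfolding Tq U_def c_def k_def[symmetric] l_def[symmetric] by (simp add: algebra_simps)
    have "\<bar>T q i j\<bar> \<le> T q q q \<and> T (Suc q) i j = T q i j - T q i q * T q q j / T q q q"
      if ij: "q \<le> i" "i < n * m" "q \<le> j" "j < n * m" for i j
    proof -
      define i1 i2 j1 j2 where ij_def: "i1 = i div m" "i2 = i mod m" "j1 = j div m" "j2 = j mod m"
      have i: "k \<le> i1" "i1 < n" "i2 < m" and j: "k \<le> j1" "j1 < n" "j2 < m"
        using ij assms(4) by (auto simp: ij_def k_def div_le_mono less_mult_imp_div_less)
      have "\<bar>c k i1 j1\<bar> = \<bar>R k i1 k\<bar> * \<bar>R k k j1\<bar> / R k k k"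
        using P by (simp add: c_def abs_mult)
      also have "\<dots> \<le> R k k k * R k k k / R k k k"
        using P p(2)[OF k] i j k by (intro divide_right_mono mult_mono) auto
      finally have c: "\<bar>c k i1 j1\<bar> \<le> R k k k" using P by simp
      have Tij: "T q i j = R k i1 j1 * S 0 i2 j2 - c k i1 j1 * (S 0 i2 j2 - S l i2 j2)"
        by (simp add: Tq U_def ij_def)
      have "\<bar>T q i j\<bar> \<le> T q q q"
        unfolding Tqq Tij
        by (rule combination_bound) (use c p(2)[OF k] s(2,3)[OF l] i j in auto)
      moreover have "T (Suc q) i j = U k (Suc l) i j"
      proof (cases "Suc l = m")
        \<comment> \<open>Crossing to the next block: \<open>S m\<close> is zero, so the coefficient
          of \<open>S 0\<close> in \<open>U k m\<close> is already stage \<open>Suc k\<close> of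
          \<open>R\<close>.\<close>
        case True
        then have "Suc q div m = Suc k" "Suc q mod m = 0"
          by (auto simp: k_def l_def div_Suc mod_Suc)
        then show ?thesis
          using True s(5)[OF l, of i2 j2] p(3)[OF k, of i1 j1] i j
          by (simp add: T_def U_def c_def ij_def[symmetric] left_diff_distrib)
      next
        case False
        then have "Suc q div m = k" "Suc q mod m = Suc l"
          by (auto simp: k_def l_def div_Suc mod_Suc)
        then show ?thesis by (simp add: T_def)
      qed
      moreover have "U k (Suc l) i j = U k l i j - c k i1 j1 * (S l i2 l * S l l j2 / S l l l)"
        using s(4)[OF l, of i2 j2] i j
        by (simp add: U_def ij_def[symmetric] right_diff_distrib)
      moreover have "T q i q * T q q j / T q q q = c k i1 j1 * (S l i2 l * S l l j2 / S l l l)"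
      proof -
        \<comment> \<open>In the block row and block column of the pivot, \<open>c\<close> coincides
          with the entry of \<open>R\<close>, which leaves only the \<open>S l\<close> part.\<close>
        have "T q i q = R k i1 k * S l i2 l" "T q q j = R k k j1 * S l l j2"
          using P unfolding Tq U_def c_def ij_def[symmetric] k_def[symmetric] l_def[symmetric]
          by (simp_all add: algebra_simps)
        then show ?thesis unfolding Tqq c_def by (simp add: field_simps)
      qed
      ultimately show ?thesis by (simp add: Tq)
    qed
    moreover have "0 < T q q q" using P by (simp add: Tqq)
    ultimately show ?thesis by blast
  qed
  then have "pivot_run (n * m) T"
    by (auto simp: pivot_run_def)
  moreover have "g * h * T 0 0 0 \<le> T (n * m - 1) (n * m - 1) (n * m - 1)"
  proof -
    let ?k = "n - 1" and ?l = "m - 1"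
    have "n * m - 1 = ?k * m + ?l"
      using assms(3,4) by (cases n) (auto simp: algebra_simps)
    moreover have "?l < m" using assms(4) by simp
    ultimately have dm: "(n * m - 1) div m = ?k" "(n * m - 1) mod m = ?l"
      by (simp_all only: div_mult_self3 mod_mult_self3 div_less mod_less)
    have P: "0 < R ?k ?k ?k" "0 < S ?l ?l ?l" "0 < R 0 0 0" "0 < S 0 0 0"
      using p(1)[of ?k] s(1)[of ?l] p(1)[of 0] s(1)[of 0] assms(3,4) by auto
    have T: "T (n * m - 1) (n * m - 1) (n * m - 1) = R ?k ?k ?k * S ?l ?l ?l"
      using P unfolding T_def U_def c_def dm by (simp add: algebra_simps)
    have "T 0 0 0 = R 0 0 0 * S 0 0 0"
      using assms(4) by (simp add: T_def U_def)
    then have "g * h * T 0 0 0 = (g * R 0 0 0) * (h * S 0 0 0)" by simp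
    also have "\<dots> \<le> R ?k ?k ?k * S ?l ?l ?l"
      using g h P assms(5,6) by (intro mult_mono) auto
    finally show ?thesis unfolding T .
  qed
  ultimately show ?thesis
    unfolding grows_def by blast
qed

section \<open>Integer certificates\<close>

text \<open>\<open>W\<close> lists the rows of a lower and \<open>V\<close> the columns of an upper triangular matrix, both without the
  zeros. Of the product matrix, stage \<open>k\<close> of the elimination is the sum over the indices \<open>q \<ge> k\<close>, and
  the pivots are the products of the diagonal entries.\<close>

definition lu_stage :: "int list list \<Rightarrow> int list list \<Rightarrow> nat \<Rightarrow> nat \<Rightarrow> nat \<Rightarrow> real" where
  "lu_stage W V k i j =
     of_int (\<Sum>q=k..<min (length (W ! i)) (length (V ! j)). W ! i ! q * V ! j ! q)"

text \<open>One pass computes the full sum and checks that every tail sum lies within the matching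
  pivot of \<open>r\<close>. With \<open>r = 0\<close> this is the pivot bound, with
  \<open>r\<close> twice the matrix entry it is the second bound of \<open>strong_run\<close>. The
  default \<open>Some 0\<close> is the empty tail; exhausting \<open>cs\<close> first would skip
  checks, so soundness asks for enough pivots.\<close>

fun tail_sum :: "int \<Rightarrow> int list \<Rightarrow> int list \<Rightarrow> int list \<Rightarrow> int option" where
  "tail_sum r (c # cs) (w # ws) (v # vs) = (case tail_sum r cs ws vs of None \<Rightarrow> None
     | Some s \<Rightarrow> if \<bar>r - (w * v + s)\<bar> \<le> c then Some (w * v + s) else None)"
| "tail_sum r _ _ _ = Some 0"

definition pivots :: "int list list \<Rightarrow> int list list \<Rightarrow> int list" where
  "pivots W V = map2 (\<lambda>w v. last w * last v) W V"

text \<open>Only the length of \<open>u\<close> counts: each list must be one longer than its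
  predecessor. The trivial \<open>list_all2\<close> compares lengths without computing
  numbers.\<close>

fun triangular :: "int list \<Rightarrow> int list list \<Rightarrow> bool" where
  "triangular u [] = True"
| "triangular u (w # ws) \<longleftrightarrow> list_all2 (\<lambda>_ _. True) (0 # u) w \<and> triangular w ws"

text \<open>The last inequality says that the ratio of last to first pivot is at least
  \<open>a / b\<close>, cleared of fractions.\<close>

definition shape :: "int \<Rightarrow> int \<Rightarrow> int list \<Rightarrow> int list list \<Rightarrow> int list list \<Rightarrow> bool" where
  "shape a b cs W V \<longleftrightarrow> triangular [] W \<and> triangular [] V \<and> list_all2 (\<lambda>_ _. True) W V
     \<and> cs \<noteq> [] \<and> list_all (\<lambda>c. 0 < c) cs \<and> 0 < b \<and> a * hd cs \<le> b * last cs"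

definition dominated :: "int list \<Rightarrow> int list list \<Rightarrow> int list list \<Rightarrow> bool" where
  "dominated cs W V \<longleftrightarrow> list_all (\<lambda>ws. list_all (\<lambda>vs. tail_sum 0 cs ws vs \<noteq> None) V) W"

text \<open>The condition on \<open>tl cs\<close> handles the positions where an extended stage is
  zero. Elsewhere a first pass finds the matrix entry \<open>s\<close>, and a second one checks the
  tails against \<open>2 * s\<close>.\<close>

definition strongly_dominated :: "int list \<Rightarrow> int list list \<Rightarrow> int list list \<Rightarrow> bool" where
  "strongly_dominated cs W V \<longleftrightarrow> list_all (\<lambda>c. 2 * hd cs \<le> c) (tl cs) \<and>
     list_all (\<lambda>ws. list_all (\<lambda>vs. case tail_sum 0 cs ws vs of None \<Rightarrow> False
       | Some s \<Rightarrow> tail_sum (2 * s) cs ws vs \<noteq> None) V) W"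

text \<open>The pivot list is an argument of the auxiliary predicates, so that \<open>code_simp\<close> evaluates it before it
  unfolds them.\<close>

definition certificate :: "int \<Rightarrow> int \<Rightarrow> int list list \<Rightarrow> int list list \<Rightarrow> bool" where
  "certificate a b W V \<longleftrightarrow> shape a b (pivots W V) W V \<and> dominated (pivots W V) W V"

definition strong_certificate :: "int \<Rightarrow> int \<Rightarrow> int list list \<Rightarrow> int list list \<Rightarrow> bool" where
  "strong_certificate a b W V \<longleftrightarrow>
     shape a b (pivots W V) W V \<and> strongly_dominated (pivots W V) W V"

section \<open>Soundness of the integer certificates\<close>

lemma tail_sum_Some:
  assumes "tail_sum r cs ws vs = Some s" "min (length ws) (length vs) \<le> length cs"
  shows "s = (\<Sum>q=0..<min (length ws) (length vs). ws ! q * vs ! q) \<and>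
    (\<forall>k<min (length ws) (length vs).
      \<bar>r - (\<Sum>q=k..<min (length ws) (length vs). ws ! q * vs ! q)\<bar> \<le> cs ! k)"
  using assms
proof (induction r cs ws vs arbitrary: s rule: tail_sum.induct)
  case (1 r c cs w ws v vs)
  obtain t where t: "tail_sum r cs ws vs = Some t" "s = w * v + t" "\<bar>r - s\<bar> \<le> c"
    using "1.prems" by (auto split: option.splits if_splits)
  define m where "m = min (length ws) (length vs)"
  let ?f = "\<lambda>q. (w # ws) ! q * (v # vs) ! q"
  have m: "min (length (w # ws)) (length (v # vs)) = Suc m"
    by (simp add: m_def)
  have IH: "t = (\<Sum>q=0..<m. ws ! q * vs ! q)"
      "\<forall>k<m. \<bar>r - (\<Sum>q=k..<m. ws ! q * vs ! q)\<bar> \<le> cs ! k"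
    using "1.IH"[OF t(1)] "1.prems"(2) by (auto simp: m_def)
  have s: "s = (\<Sum>q=0..<Suc m. ?f q)"
    unfolding sum.atLeast0_lessThan_Suc_shift t(2) IH(1) by simp
  have "\<bar>r - (\<Sum>q=k..<Suc m. ?f q)\<bar> \<le> (c # cs) ! k" if "k < Suc m" for k
  proof (cases k)
    case 0
    then show ?thesis using s t(3) by simp
  next
    case (Suc k')
    then show ?thesis
      using IH(2) that unfolding Suc sum.shift_bounds_Suc_ivl by simp
  qed
  with s show ?case unfolding m by blast
qed auto

lemma length_triangular:
  assumes "triangular u W" "i < length W"
  shows "length (W ! i) = length u + Suc i"
  using assms
proof (induction u W arbitrary: i rule: triangular.induct)
  case (2 u w ws)
  then show ?case by (cases i) (auto dest: list_all2_lengthD)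
qed simp

lemma shapeD:
  assumes "shape a b (pivots W V) W V" and n: "length W = n"
  shows "length W = n" "length V = n" "0 < n" "length (pivots W V) = n"
    and "i < n \<Longrightarrow> length (W ! i) = Suc i" "i < n \<Longrightarrow> length (V ! i) = Suc i"
    and "i < n \<Longrightarrow> real_of_int (pivots W V ! i) = lu_stage W V i i i"
    and "i < n \<Longrightarrow> 0 < lu_stage W V i i i"
    and "real_of_int a / real_of_int b * lu_stage W V 0 0 0 \<le> lu_stage W V (n - 1) (n - 1) (n - 1)"
proof -
  show W: "length W = n" "\<And>i. i < n \<Longrightarrow> length (W ! i) = Suc i"
    and V: "length V = n" "\<And>i. i < n \<Longrightarrow> length (V ! i) = Suc i"
    and n: "0 < n"
    using assms length_triangular[of "[]"]
    by (auto simp: shape_def pivots_def dest: list_all2_lengthD)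
  show len: "length (pivots W V) = n"
    using W V by (simp add: pivots_def)
  show piv: "real_of_int (pivots W V ! i) = lu_stage W V i i i" if "i < n" for i
  proof -
    have "W ! i \<noteq> []" "V ! i \<noteq> []" using W(2)[OF that] V(2)[OF that] by auto
    then show ?thesis
      using W V that by (simp add: pivots_def lu_stage_def last_conv_nth)
  qed
  show "0 < lu_stage W V i i i" if "i < n" for i
    using assms that len piv[OF that, symmetric] by (simp add: shape_def list_all_length)
  have "a * pivots W V ! 0 \<le> b * pivots W V ! (n - 1)" and b: "0 < b"
    using assms n len by (auto simp: shape_def hd_conv_nth last_conv_nth simp flip: length_greater_0_conv)
  then have "real_of_int (a * pivots W V ! 0) \<le> real_of_int (b * pivots W V ! (n - 1))"
    by (simp only: of_int_le_iff)
  then show "real_of_int a / real_of_int b * lu_stage W V 0 0 0 \<le> lu_stage W V (n - 1) (n - 1) (n - 1)"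
    using b n piv[of 0] piv[of "n - 1"] by (simp add: field_simps)
qed

text \<open>Passing to the next stage drops the summand \<open>q = k\<close>. That summand is the
  rank-one update, since row and column \<open>k\<close> of stage \<open>k\<close> consist of this
  summand alone.\<close>

lemma lu_stage_Suc:
  assumes "shape a b (pivots W V) W V" "length W = n" "k < n" "i < n" "j < n"
  shows "lu_stage W V (Suc k) i j
    = lu_stage W V k i j - lu_stage W V k i k * lu_stage W V k k j / lu_stage W V k k k"
proof -
  note s = shapeD[OF assms(1,2)]
  have piv: "lu_stage W V k k k = W ! k ! k * V ! k ! k" and "0 < lu_stage W V k k k"
    using s assms(3) by (auto simp: lu_stage_def)
  then have nz: "W ! k ! k \<noteq> 0" "V ! k ! k \<noteq> 0" by auto
  \<comment> \<open>The lists \<open>V ! k\<close> and \<open>W ! k\<close> end at index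
    \<open>k\<close>, so at most the summand \<open>q = k\<close> remains.\<close>
  have row: "lu_stage W V k i k = (if k \<le> i then W ! i ! k * V ! k ! k else 0)"
    and col: "lu_stage W V k k j = (if k \<le> j then W ! k ! k * V ! j ! k else 0)"
    using s assms by (auto simp: lu_stage_def min_def)
  show ?thesis
  proof (cases "k \<le> i \<and> k \<le> j")
    case True
    then have "k < min (length (W ! i)) (length (V ! j))"
      using s(5,6) assms(4,5) by (simp add: less_Suc_eq_le)
    then have "lu_stage W V k i j = W ! i ! k * V ! j ! k + lu_stage W V (Suc k) i j"
      unfolding lu_stage_def by (subst sum.atLeast_Suc_lessThan) auto
    then show ?thesis
      unfolding row col piv using True nz by simp
  next
    case False
    \<comment> \<open>Outside the active block both stages and the update are empty sums; this is
      the extension by zero.\<close>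
    then show ?thesis
      using s assms unfolding row col by (auto simp: lu_stage_def)
  qed
qed

lemma lu_stage_bound:
  assumes "shape a b (pivots W V) W V" "length W = n" "i < n" "j < n"
    and "tail_sum r (pivots W V) (W ! i) (V ! j) = Some s"
  shows "of_int s = lu_stage W V 0 i j"
    and "k \<le> i \<Longrightarrow> k \<le> j \<Longrightarrow> \<bar>of_int r - lu_stage W V k i j\<bar> \<le> lu_stage W V k k k"
proof -
  note s = shapeD[OF assms(1,2)]
  have m: "min (length (W ! i)) (length (V ! j)) \<le> length (pivots W V)"
    using s assms by simp
  note t = tail_sum_Some[OF assms(5) m]
  show "of_int s = lu_stage W V 0 i j"
    using t by (simp add: lu_stage_def)
  assume k: "k \<le> i" "k \<le> j"
  then have "real_of_int \<bar>r - (\<Sum>q=k..<min (length (W ! i)) (length (V ! j)). W ! i ! q * V ! j ! q)\<bar>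
      \<le> real_of_int (pivots W V ! k)"
    using s assms t by (intro of_int_le_iff[THEN iffD2]) auto
  then show "\<bar>of_int r - lu_stage W V k i j\<bar> \<le> lu_stage W V k k k"
    using s(7)[of k] k assms by (simp add: lu_stage_def)
qed

lemma certificate_grows:
  assumes "certificate a b W V"
    and n: "length W = n"
  shows "grows n (of_int a / of_int b)"
proof -
  have shape: "shape a b (pivots W V) W V" and dom: "dominated (pivots W V) W V"
    using assms by (auto simp: certificate_def)
  note s = shapeD[OF shape n]
  have "\<bar>lu_stage W V k i j\<bar> \<le> lu_stage W V k k k" if "k \<le> i" "i < n" "k \<le> j" "j < n" for k i j
  proof -
    have "tail_sum 0 (pivots W V) (W ! i) (V ! j) \<noteq> None"
      using dom s(1,2) that by (simp add: dominated_def list_all_length)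
    then obtain t where "tail_sum 0 (pivots W V) (W ! i) (V ! j) = Some t"
      by blast
    from lu_stage_bound(2)[OF shape n _ _ this, of k] that show ?thesis by simp
  qed
  then have "pivot_run n (lu_stage W V)"
    using s lu_stage_Suc[OF shape n] by (auto simp: pivot_run_def)
  with s show ?thesis unfolding grows_def by blast
qed

text \<open>The list checks cover the positions with \<open>k \<le> i\<close> and
  \<open>k \<le> j\<close>. Elsewhere stage \<open>k\<close> is zero, and twice a matrix entry is at
  most \<open>2 * ?S 0 0 0\<close>, which \<open>double\<close> bounds by the pivot.\<close>

lemma strong_certificate_strongly_grows:
  assumes "strong_certificate a b W V"
    and n: "length W = n"
  shows "strongly_grows n (of_int a / of_int b)"
proof -
  let ?S = "lu_stage W V"
  have shape: "shape a b (pivots W V) W V" and dom: "strongly_dominated (pivots W V) W V"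
    using assms by (auto simp: strong_certificate_def)
  note s = shapeD[OF shape n]
  have bounds: "\<bar>?S k i j\<bar> \<le> ?S k k k \<and> \<bar>2 * ?S 0 i j - ?S k i j\<bar> \<le> ?S k k k"
    if "k \<le> i" "k \<le> j" "i < n" "j < n" for k i j
  proof -
    have "case tail_sum 0 (pivots W V) (W ! i) (V ! j) of None \<Rightarrow> False
        | Some t \<Rightarrow> tail_sum (2 * t) (pivots W V) (W ! i) (V ! j) \<noteq> None"
      using dom s(1,2) that by (simp add: strongly_dominated_def list_all_length)
    then obtain t where t: "tail_sum 0 (pivots W V) (W ! i) (V ! j) = Some t"
        "tail_sum (2 * t) (pivots W V) (W ! i) (V ! j) \<noteq> None"
      by (auto split: option.splits)
    then obtain t' where t': "tail_sum (2 * t) (pivots W V) (W ! i) (V ! j) = Some t'" by auto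
    show ?thesis
      using lu_stage_bound(1)[OF shape n _ _ t(1)] lu_stage_bound(2)[OF shape n _ _ t(1), of k]
        lu_stage_bound(2)[OF shape n _ _ t', of k] that
      by simp
  qed
  have double: "2 * ?S 0 0 0 \<le> ?S k k k" if "0 < k" "k < n" for k
  proof -
    have "pivots W V \<noteq> []" using s(3,4) by auto
    moreover have "2 * hd (pivots W V) \<le> tl (pivots W V) ! (k - 1)"
      using dom s(4) that by (simp add: strongly_dominated_def list_all_length)
    ultimately have "2 * pivots W V ! 0 \<le> pivots W V ! k"
      using s(4) that by (simp add: hd_conv_nth nth_tl)
    then have "real_of_int (2 * pivots W V ! 0) \<le> real_of_int (pivots W V ! k)"
      by (simp only: of_int_le_iff)
    then show ?thesis using s(7)[of 0] s(7)[of k] s(3) that by simp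
  qed
  have zero: "?S k i j = 0" if "i < k \<or> j < k" "i < n" "j < n" for k i j
    using that s by (auto simp: lu_stage_def)
  have "\<bar>?S k i j\<bar> \<le> ?S k k k \<and> \<bar>2 * ?S 0 i j - ?S k i j\<bar> \<le> ?S k k k"
    if "k < n" "i < n" "j < n" for k i j
  proof (cases "k \<le> i \<and> k \<le> j")
    case True
    then show ?thesis using bounds that by blast
  next
    case False
    then show ?thesis
      using zero[of i k j] that double[of k] bounds[of 0 i j] s(8)[of k] by auto
  qed
  then have "strong_run n ?S"
    using s lu_stage_Suc[OF shape n] zero by (auto simp: strong_run_def)
  with s show ?thesis unfolding strongly_grows_def by blast
qed

section \<open>The matrices\<close>

text \<open>The lists factor the Hadamard matrix with rows (1, -1) and (1, 1), whose pivots are 1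
  and 2.\<close>

lemma strongly_grows_2: "strongly_grows 2 2"
proof -
  have "strong_certificate 2 1 [[1], [1, 2]] [[1], [-1, 1]]"
    by code_simp
  from strong_certificate_strongly_grows[OF this, of 2] show ?thesis by simp
qed

text \<open>For dimensions 11, 12 and 13 the certified ratio is exactly 1.0045 times the
  dimension.\<close>

lemma grows_11: "grows 11 11.0495"
proof -
  have "certificate 110495 10000
    [[150000], [149975, 299949], [-60324, 89677, 299986], [-149981, -299941, -294818, 300020],
     [-149983, 31, 290377, -191041, 374307], [149973, 270212, 270249, -289509, 236652, 419073],
     [133790, 49087, 24437, 107940, -52694, 191118, 424423], [-149995, -65296, 234617, 132481,
     -2032, 82766, 422195, 424505], [-110229, 39782, -5, -132117, 353493, 309113, 75, -404402,
     828820], [149955, 299927, -8, 74321, -352429, 110390, -2520, 404323, 5054, 828734],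
     [-60350, 89655, 299980, 74300, 247563, 932, -134876, -424498, 828664, 828733, 1657458]]
    [[300000], [-299956, 300000], [299951, -299989, 300000], [64362, 43517, 75645, 300000],
     [299992, 20, -89684, 211794, 300000], [-113510, -93267, -8980, -8846, -163243, 300000],
     [-76929, 188486, -157135, -154404, 132469, -281513, 300000], [171523, -40583, -41713,
     154170, 299998, 36158, -171241, 300000], [299864, -299947, -41, -299990, -35445, -208489,
     -61, 299998, 300000], [-299459, -291, -210134, -206533, 57830, 5186, 269417, -299951,
     -299998, 300000], [-299948, 299936, -299981, -168536, -93723, 151266, -65774, 299997,
     -5509, -299997, 300000]]"
    by code_simp
  from certificate_grows[OF this, of 11] show ?thesis by simp
qed

lemma grows_12: "grows 12 12.054"
proof -
  have "certificate 120540 10000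
    [[500], [-494, 977], [344, -840, 978], [-418, -65, 777, 1119], [216, -695, 139, 575, 1195],
     [-493, 935, -643, -303, -808, 1288], [-471, 826, 109, 580, 263, 459, 1482], [469, -11,
     -778, -1113, -146, -700, -1130, 1633], [469, -14, 204, 381, 505, -1178, -128, 1539, 1628],
     [491, 3, -775, -150, -313, 823, 1121, 1, -1434, 3055], [-258, -237, -132, 450, 1113, 302,
     -130, 937, 1622, -3048, 3053], [469, -926, 969, -58, -620, 416, -1036, 122, -1447, -163,
     -3044, 6095]]
    [[500], [497, 500], [319, 416, 500], [239, 78, -265, 500], [153, 330, 283, -343, 500], [395,
     281, 356, -296, 400, 500], [-473, -469, 17, -336, -179, -215, 500], [-455, -415, 56, -16,
     -366, 83, 293, 500], [479, -8, 17, -54, -237, 225, -18, -255, 500], [-490, 5, 418, -258,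
     375, 384, -440, -84, 499, 500], [482, 476, 492, 88, -118, -161, -280, 35, -498, 32, 500],
     [-437, 30, -66, -314, 47, -433, -67, -498, 496, 498, 500, 500]]"
    by code_simp
  from certificate_grows[OF this, of 12] show ?thesis by simp
qed

lemma grows_13: "grows 13 13.0585"
proof -
  have "certificate 130585 10000
    [[333], [331, 656], [-315, 22, 662], [65, -222, -593, 688], [-309, -611, -63, 444, 746],
     [-295, 27, -13, 524, -169, 739], [323, 633, 576, -682, -25, -646, 1067], [60, -270, -254,
     459, 659, -76, -514, 1134], [323, 591, -9, -23, -468, -339, 689, -884, 1148], [282, -39,
     -637, -83, -688, -626, -230, 92, -128, 1173], [-269, -585, 66, -195, -92, -395, 282, -736,
     1102, -1172, 2236], [-323, 11, -2, -126, 85, -555, 1045, 17, -70, -1077, -190, 2234],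
     [-289, 44, 654, 76, 30, 58, -239, 884, 143, -1169, 2211, 2233, 4467]]
    [[1000], [-979, 1000], [987, -900, 1000], [632, 14, 666, 1000], [-482, 728, -738, -632,
     1000], [-285, 232, -635, -925, 136, 1000], [972, -971, 275, 310, -239, 601, 1000], [840,
     -923, -69, -69, -812, 674, 980, 1000], [-702, 505, -846, -968, 184, 855, -33, 587, 1000],
     [-975, -12, -3, -391, 249, 392, 606, 653, 895, 1000], [-849, 906, -934, -339, 956, 518,
     652, -319, -621, 908, 1000], [983, -695, -3, -796, 755, 940, -108, -611, 510, 990, -3,
     1000], [-983, -3, -960, -254, 49, -664, 76, -389, 21, -860, -972, -1000, 1000]]"
    by code_simp
  from certificate_grows[OF this, of 13] show ?thesis by simp
qed

lemma grows_14: "grows 14 15.0675"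
proof -
  have "certificate 150675 10000
    [[1000], [992, 1977], [394, 1388, 1984], [566, 75, -1463, 2182], [-626, -1614, -1297, 1333,
     2415], [-181, 0, -713, -355, -1448, 2472], [996, 1718, -266, 1012, 872, 931, 2494], [547,
     -450, -1967, 850, 496, 1448, 2018, 3494], [943, -63, -488, -275, -2388, 1648, -1402, 810,
     3808], [971, 1481, 567, 1162, 1370, -2087, -619, -2929, -2495, 3916], [-980, 14, -40, 595,
     553, 1738, -619, -3000, 1503, 1948, 3900], [-549, 437, 1363, -2076, 49, 662, 2297, -402,
     -3618, 2197, -3688, 7582], [912, 1743, 1834, 343, -841, 289, 1350, 2270, 2408, -45, -3492,
     7354, 7592], [-974, -1941, 26, 422, 2394, -602, 2085, -317, 302, -2989, -3711, -191, -7591,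
     15167]]
    [[2000], [-1982, 2000], [1926, -1967, 2000], [-874, -138, 1275, 2000], [1978, 16, -796,
     -1955, 2000], [1976, -1325, 1541, -86, 1060, 2000], [-1954, 258, -562, 1008, -1991, -1263,
     2000], [-1981, 1901, 41, -437, 1847, 93, -1813, 2000], [-1610, 1807, -1949, -1841, -65,
     -1788, 1427, -808, 2000], [-639, -689, -263, -894, 289, -889, 502, 689, 1175, 2000], [1840,
     -1931, 1991, 19, -577, -434, 1962, 279, -263, -204, 2000], [1969, -1162, -575, 57, 217,
     -694, -679, -608, -783, -1998, 1998, 2000], [1077, -1546, -136, -1231, 676, 1066, 1286,
     -1997, -61, -60, -1898, -1936, 2000], [1667, 160, -1264, -1997, 136, 357, -1082, 562,
     -1826, 38, 1987, -61, 2000, 2000]]"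
    by code_simp
  from certificate_grows[OF this, of 14] show ?thesis by simp
qed

lemma grows_15: "grows 15 16.072"
proof -
  have "certificate 160720 10000
    [[166], [165, 330], [-164, -83, 325], [-103, 61, 226, 360], [122, 150, -16, 191, 369], [101,
     44, 16, -159, -207, 416], [-146, -26, 304, 36, -189, 382, 415], [156, 310, 13, -5, -98, 45,
     -105, 412], [-136, 27, -30, 278, -38, -65, -55, 405, 664], [151, 15, -283, -21, 293, -395,
     -413, -118, -440, 675], [148, 276, 20, 190, 366, 81, -12, 82, -248, 518, 684], [-111, 42,
     269, 358, 271, -277, 163, -410, 32, 4, -13, 684], [157, 162, -309, 59, 45, -330, -3, 242,
     -72, 591, 682, -683, 1339], [146, 307, -304, -106, 212, -30, 282, -408, -659, -22, -8,
     -674, 1312, 1345], [-161, 0, -4, -48, 35, -302, -176, 175, 473, -638, 62, -683, -10, -1345,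
     2683]]
    [[500], [-498, 500], [491, -4, 500], [365, -415, -154, 500], [-297, 33, 108, -364, 500],
     [-426, -27, -442, 186, 232, 500], [445, -311, 64, -16, -87, -271, 500], [29, -174, 159,
     -291, 407, -101, 351, 500], [465, 16, -15, -89, 106, 97, -55, -387, 500], [-438, 456, 123,
     -498, -1, 60, -33, -400, 476, 500], [233, -346, -137, 438, -391, 154, -396, -229, -151,
     -332, 500], [-478, 9, -491, -57, -59, -114, 80, 407, -474, -452, 417, 500], [-308, -89, 74,
     -303, 492, 407, -491, 322, 24, -231, -111, 482, 500], [400, -10, 442, -124, -266, -490,
     -41, -372, 436, -5, 465, -479, -499, 500], [482, -483, 51, -38, -162, 32, 198, 386, 35,
     345, 3, 481, -9, 500, 500]]"
    by code_simp
  from certificate_grows[OF this, of 15] show ?thesis by simp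
qed

text \<open>The value is 1.0045 * 17. The strong form allows Kronecker powers, and a ratio above 16
  makes these superlinear.\<close>

lemma strongly_grows_16: "strongly_grows 16 17.0765"
proof -
  have "strong_certificate 170765 10000
    [[250], [250, 500], [-250, 0, 500], [227, 365, -428, 603], [-82, 159, 199, -289, 599], [84,
     186, -332, 125, 275, 647], [108, 103, 101, -171, -151, -474, 625], [107, 181, -309, 407,
     -169, 178, -364, 678], [242, 16, -19, 169, -395, -638, 22, 430, 659], [175, 132, -416, 507,
     -28, 499, -622, 141, -478, 968], [226, -18, -472, -16, -175, -131, 513, -455, 317, -837,
     1065], [-232, -470, 294, -528, -150, 24, -203, -129, -492, 49, 444, 1160], [-229, -475, 8,
     -277, 242, 71, -335, 146, 430, -47, -431, -1156, 1169], [42, 289, 187, -268, 592, -89, -72,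
     -399, 334, -777, 1062, -32, 1150, 2156], [178, 416, -327, 78, 18, 398, -197, 640, 432,
     -893, -145, 89, 974, 1956, 2156], [-242, -49, -6, 292, -325, -234, -237, 316, 650, 117, 97,
     266, -1165, 129, 2155, 4309]]
    [[1000], [-1000, 1000], [1000, 0, 1000], [370, -402, 680, 1000], [783, -830, 361, 780,
     1000], [743, 21, 838, -106, -637, 1000], [153, -477, 439, 663, 166, 528, 1000], [667, -822,
     382, 338, 759, 157, 747, 1000], [934, -370, 942, 210, -377, 967, 50, -428, 1000], [-62,
     516, -420, -984, -71, 247, 292, -21, 824, 1000], [131, -417, 488, 147, 329, 559, 864, 989,
     259, 676, 1000], [770, -856, -107, 557, 981, -58, -1, -382, 733, -129, -776, 1000], [-966,
     14, -53, 678, -172, 307, 944, -263, 887, 969, -97, 824, 1000], [787, -889, -97, -238, -148,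
     -168, 195, -38, -814, 128, -269, -732, -891, 1000], [980, -177, 971, 775, 646, -325, 220,
     -128, -744, 93, 664, -20, 970, -999, 1000], [960, -2, 23, 64, -256, 351, 447, 269, -745,
     -759, -892, 551, 997, 9, -1000, 1000]]"
    by code_simp
  from strong_certificate_strongly_grows[OF this, of 16] show ?thesis by simp
qed

lemma grows_17: "grows 17 18.081"
proof -
  have "certificate 180810 10000
    [[125], [-124, 246], [113, -236, 245], [64, 56, -169, 302], [29, 62, 51, 133, 299], [115,
     -204, 221, -89, 132, 325], [-77, 2, 1, 48, -101, -196, 326], [54, 56, 71, -81, -51, -52,
     -181, 343], [111, -190, 129, -124, 40, 124, 26, -192, 342], [-117, 229, -215, -49, -237,
     -60, -78, 30, -117, 338], [-98, -23, -89, 77, 63, 27, -30, -18, -234, 279, 528], [-6, 124,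
     47, 112, 65, -136, -95, 320, -334, -150, 210, 580], [-113, -9, -69, 19, -178, -293, 168,
     -123, 251, -217, -471, -456, 636], [-17, -105, 190, -37, -38, 147, 180, -182, -111, -189,
     -412, -404, 634, 634], [-111, 223, 10, 57, 281, 145, -307, -36, 17, -210, 130, 558, 176,
     571, 1188], [-23, 144, -165, 221, 198, -184, 115, -329, -23, 296, -66, 60, 101, -499,
     -1075, 1188], [-122, 49, 108, -295, 34, -40, 147, 20, -41, -272, -519, 129, -142, 559, -2,
     -1187, 2375]]
    [[500], [496, 500], [101, 303, 500], [-482, -113, 311, 500], [-81, -289, -454, -332, 500],
     [-338, -21, -100, 217, -196, 500], [466, 391, -91, -137, 102, 252, 500], [-161, -279, -439,
     -93, 373, 161, 379, 500], [-346, 62, -27, 249, 115, 278, 234, 380, 500], [-282, 104, 473,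
     100, 79, 23, 142, 223, 282, 500], [402, 422, 113, -299, -215, -137, 178, -365, -10, -399,
     500], [-447, -465, 3, 378, -237, 252, 108, 120, 199, 360, -351, 500], [407, -21, -445,
     -488, 274, 91, 334, 325, 118, 280, 84, 222, 500], [452, -19, 24, 122, 106, -387, 77, 131,
     254, 482, 58, -35, -79, 500], [386, -34, 29, -254, 283, -178, 294, -131, -492, 332, -411,
     -50, 32, -496, 500], [-366, -416, -474, -313, 136, -140, 110, 387, 14, -306, -57, -216,
     -498, 496, 28, 500], [469, 353, 365, 242, -492, 261, 134, 66, -196, -334, 389, -492, 72,
     -496, 495, 500, 500]]"
    by code_simp
  from certificate_grows[OF this, of 17] show ?thesis by simp
qed

text \<open>The value is 1.0045 * 20, enough for dimension 19 as well after padding.\<close>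

lemma grows_18: "grows 18 20.09"
proof -
  have "certificate 200900 10000
    [[166], [-165, 325], [117, -281, 328], [-155, 46, 194, 366], [97, -255, 34, -211, 400],
     [-116, -43, -23, -76, 236, 403], [71, 27, -78, -227, -63, -266, 444], [147, -307, 135, -3,
     -11, -3, -192, 451], [149, 10, -45, 84, -70, -293, -6, 137, 491], [-129, 284, -287, -115,
     23, -62, 180, -54, 233, 476], [149, -15, 53, 149, -87, 4, -293, 301, 93, -395, 495], [-139,
     -25, -26, 177, 148, 109, -374, 305, 461, -44, 475, 794], [-130, -5, -55, 159, 23, 353,
     -189, -158, -453, -320, -215, -660, 857], [133, -263, 295, 297, -7, -221, 107, -167, 175,
     94, -413, 42, -344, 875], [137, -279, -19, 44, -173, 67, -65, 357, 101, 360, -473, -734,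
     -41, -54, 861], [131, 6, -271, -89, -269, -356, -131, 57, -101, 176, 215, 584, -843, -65,
     -830, 1685], [157, -201, -105, -336, 395, -44, 377, 44, -2, -173, 471, -64, -284, 235, 827,
     -1669, 1687], [34, -190, 309, 315, -290, -318, 147, 194, -60, -267, 412, -19, 257, -873,
     853, 4, -1686, 3370]]
    [[500], [496, 500], [394, 453, 500], [154, -107, -392, 500], [464, 281, -108, 428, 500],
     [451, 187, 184, -125, -276, 500], [49, -184, -353, 449, -66, 261, 500], [78, 286, -24, 205,
     131, 94, 321, 500], [-190, -336, 9, -226, -437, 325, 25, -345, 500], [401, 372, 325, 173,
     393, -135, -149, 143, -346, 500], [381, -51, 68, 169, -222, 404, 69, -328, -3, 389, 500],
     [437, 244, -190, 370, 73, 370, 488, 476, -276, -174, -452, 500], [488, -2, -30, 3, 86,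
     -115, 45, 48, -168, 338, 6, 300, 500], [-423, -150, 260, -420, -443, -147, -61, 97, -117,
     292, 464, -32, 341, 500], [405, 452, -3, -107, -50, -29, -353, -154, -267, -98, -388, 498,
     7, 67, 500], [66, 285, 387, -436, 108, 130, 94, -85, 44, 74, 420, -3, 316, 499, 498, 500],
     [375, 435, 489, 69, 17, -16, 212, -63, 87, -150, -305, 428, 458, -235, 486, 489, 500],
     [300, 392, 405, -352, -247, 432, -143, 162, 341, 141, -363, -57, 151, 86, -484, 17, 500,
     500]]"
    by code_simp
  from certificate_grows[OF this, of 18] show ?thesis by simp
qed

text \<open>The value is 1.0045 * 24, enough for dimensions 20 to 23.\<close>

lemma grows_20: "grows 20 24.108"
proof -
  have "certificate 241080 10000
    [[1250], [-1247, 2489], [123, -1371, 2480], [-1051, 162, 2120, 2993], [1239, -1176, 869,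
     -872, 2929], [-1199, 2435, -1557, -794, -2034, 3352], [201, -1445, 1722, 1960, -1418,
     -1683, 3502], [-999, 1913, 319, 490, -1027, 2617, -1964, 3657], [-1248, 165, -147, -402,
     -356, -1201, -791, 357, 3711], [1131, -184, -2184, -927, 626, -1702, 1250, -2779, -2136,
     4008], [1027, -23, -2239, -901, 1604, 317, -597, -539, -1816, 3123, 4196], [-1239, 2010,
     482, 1283, -2263, 2946, -396, 1088, -2069, 285, -1884, 4358], [843, 406, 11, -1795, 2917,
     1091, -2063, 984, 893, -1672, 2023, -4122, 4416], [459, -1704, -21, -1813, 1802, 75, -2548,
     -1448, 132, 2556, 2890, 859, -3821, 6974], [966, -2196, 2457, -735, 571, 925, 1436, 60,
     -830, -2634, -2931, 3285, 1569, -5265, 7490], [1195, -1997, 2033, 1359, 2302, -807, -1366,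
     2303, -2301, 2229, -197, -192, 2140, 1072, -3495, 7873], [-883, -346, -31, -672, -1959,
     2084, 963, 613, 2207, -1202, 2589, -1684, 3307, 600, -3711, 7871, 7913], [-1225, 2453, 39,
     -17, 678, -354, 1026, 247, -1082, 3022, 3598, 1266, 2546, -5410, 7323, 46, 7387, 15236],
     [181, -1416, 2462, -16, 2174, -2358, 1856, -3626, 1765, 634, -2312, -2326, 4384, -6494,
     -1358, -224, 7462, -310, 15225], [1240, -117, -1355, -2982, 541, -305, -1469, 1539, 3022,
     484, 543, 716, -4393, -521, -34, 1031, -6801, -14711, 15225, 30446]]
    [[5000], [4987, 5000], [4950, 4934, 5000], [3612, -651, -3042, 5000], [-4985, -1280, -2280,
     2011, 5000], [-1572, -3290, -1823, 2361, 2642, 5000], [-1854, -932, -2260, 224, 3278, 2862,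
     5000], [-4963, -2602, -1816, -1773, 2322, -972, 3345, 5000], [4826, 1588, -1812, 4974,
     2088, 2511, 991, -790, 5000], [4950, 984, 2096, 2281, -1180, 3634, 860, -415, 3668, 5000],
     [4937, 2633, 3728, 749, -3799, -2384, -2362, -2791, -1278, -2923, 5000], [2231, 1190,
     -1967, 4187, 3482, 268, -184, -1423, 3236, -1868, 2027, 5000], [4708, -146, -2132, 1092,
     -3223, -2759, -4307, -1502, 1330, -347, 888, 3962, 5000], [3814, 4404, 10, -991, 1973,
     -1744, 3891, 1065, 3007, 535, -1630, 3754, 4429, 5000], [4066, -467, -2015, 4944, -413,
     3638, 1158, 360, 4863, 4516, -3662, -3520, 1646, 3463, 5000], [4046, 4535, -204, 3403,
     -940, 154, -2253, -4994, -201, -1360, -1518, -3562, -3678, -30, 3692, 5000], [4983, 2006,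
     -1636, 767, 1543, -1178, -789, 2910, -757, -2428, -2156, -1315, -4984, 411, 10, -626,
     5000], [2784, -1106, 1695, -2243, -662, 3516, -548, -3211, 3753, -447, -295, 63, -3462,
     -4349, -4422, 2226, -4999, 5000], [-4824, -4903, -4988, 52, -560, 1044, 2733, 536, -2462,
     -4389, -185, 1010, 3880, 4989, -253, 836, -4998, 4999, 5000], [-4385, -4698, -50, 829,
     2355, 1586, -2169, -2187, -2359, 952, -3628, -138, 2913, 153, -3277, -4999, 4929, 207,
     -4999, 5000]]"
    by code_simp
  from certificate_grows[OF this, of 20] show ?thesis by simp
qed

text \<open>The value is 1.0045 * 28, enough for dimensions 24 to 27.\<close>

lemma grows_24: "grows 24 28.126"
proof -
  have "certificate 281260 10000
    [[250], [249, 494], [81, -168, 495], [-214, -381, 402, 615], [-236, 3, -351, -272, 613],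
     [-207, -88, 62, 419, 290, 659], [127, 356, -7, -39, -155, 282, 672], [179, 93, 299, -141,
     37, 143, 381, 690], [105, 235, -368, -324, 288, -75, 58, 497, 718], [-213, -258, 277, 173,
     -53, 153, 190, -19, -604, 712], [-81, -312, 464, 284, 103, 296, 295, 419, 113, 399, 733],
     [-227, -329, 344, 123, -87, -424, -186, -389, -283, 17, -437, 819], [-159, -357, -42, -173,
     369, -7, -68, 4, 29, -66, 124, -383, 878], [-143, -105, -271, -288, 448, -247, -636, 92,
     349, -225, -306, -76, 548, 959], [7, -165, -42, 196, 189, 443, -94, 201, 69, -271, -139,
     161, 256, 513, 984], [201, -34, 60, -175, 66, -325, -22, 552, 635, 63, 515, -294, 276,
     -236, -758, 1007], [-149, -363, -29, 287, 290, -8, -149, -286, -432, 453, -230, 545, -400,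
     -204, 37, -508, 1044], [134, 339, 32, 187, 16, 71, 419, -124, 87, -71, -312, -117, 106,
     298, 671, 86, -997, 1655], [-99, -336, 307, 484, -369, -255, 41, -49, -335, -59, 87, 432,
     34, 153, 929, -635, -323, 1201, 1804], [-124, -359, 27, 307, -236, 196, -266, -640, -91,
     25, 242, -553, 409, 517, -413, 398, -777, -300, -1091, 1852], [-215, 2, -392, -334, 130, 8,
     210, 308, -201, 637, -211, -157, 371, 948, -63, -200, 848, 63, 874, -1845, 1864], [-216,
     24, -32, 365, 354, 226, -239, -51, 250, 137, 469, -628, -306, 90, 107, -953, 973, -1512,
     136, 2, 1746, 3585], [-8, -15, 243, -90, 207, -231, -382, -191, -390, 500, 463, 301, 150,
     292, 402, 506, 200, -949, -1678, -253, 1844, -14, 3588], [-70, 159, -93, 209, 294, 616,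
     547, -43, -558, 4, 87, -627, 810, -262, -9, -349, 1032, 154, -314, 412, 1626, 3484, -3587,
     7169]]
    [[1000], [-989, 1000], [-986, 987, 1000], [701, -56, -621, 1000], [916, -85, 255, 228,
     1000], [-169, -390, 201, -815, -533, 1000], [302, -621, -326, 233, 420, -647, 1000], [-756,
     323, -245, 481, -559, 74, -499, 1000], [-764, -66, 573, -351, 176, 21, 546, -752, 1000],
     [632, 50, -168, 217, -114, 116, -16, -390, 567, 1000], [-265, -58, -421, -17, 40, -414,
     323, -184, -309, -516, 1000], [-295, 59, -422, -183, -46, 458, 161, -254, 130, -238, 673,
     1000], [-404, 625, -139, 476, -422, 189, -53, -159, 641, 427, 181, 695, 1000], [465, -345,
     139, -279, 497, -319, 686, -190, -495, -801, 651, -161, -721, 1000], [-544, 41, 270, -724,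
     -722, 228, -576, -161, 677, 870, -369, -550, 183, -748, 1000], [-884, -27, -344, 295, -11,
     -127, -110, 273, -421, -169, -230, -664, -662, -148, 476, 1000], [-554, -215, 440, -242,
     -465, -231, 556, -645, 505, -418, -212, -381, -424, 148, 574, 883, 1000], [-876, 493, 803,
     -905, -257, 747, -875, -383, 171, -318, 736, -100, -500, 267, -221, 204, 776, 1000], [831,
     64, 339, -109, 739, 340, 188, -955, 30, 428, -392, -181, 166, -238, 370, 907, -208, -721,
     1000], [-946, 594, 750, -846, 78, -142, 199, -72, 273, 404, -542, -190, -343, 205, 655,
     911, 786, -120, 609, 1000], [905, -926, -116, -464, 222, 736, -327, 205, 112, -197, -592,
     448, -430, -538, -463, 68, -801, 100, 357, 298, 1000], [881, -905, -929, -40, -526, 132,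
     -167, 37, -446, 247, 645, 752, -60, 697, -212, 302, -568, 128, -483, -996, -998, 1000],
     [-407, -237, -391, -420, -959, 921, -71, 469, -425, -315, -304, 37, 458, 247, -900, 62,
     750, 996, 35, -37, -956, 967, 1000], [641, -793, 84, 65, 410, 73, 720, -861, 957, 808,
     -803, -764, -771, 660, -237, -175, -613, -852, 945, -329, -992, -32, 999, 1000]]"
    by code_simp
  from certificate_grows[OF this, of 24] show ?thesis by simp
qed

section \<open>Growth for all dimensions\<close>

text \<open>The summand 1 pays for odd dimensions: doubling \<open>k\<close> gives 1.0045 * (2 * k +
  2), which is enough for both 2 * k and 2 * k + 1.\<close>

lemma grows_from_14:
  assumes "14 \<le> n"
  shows "grows n (1.0045 * (real n + 1))"
  using assms
proof (induction n rule: less_induct)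
  case (less n)
  show ?case
  proof (cases "n < 28")
    case True
    with less.prems consider "n = 14" | "n = 15" | "n = 16" | "n = 17" | "18 \<le> n" "n \<le> 19"
      | "20 \<le> n" "n \<le> 23" | "24 \<le> n" "n \<le> 27"
      by linarith
    then show ?thesis
    proof cases
      case 1
      with grows_14 show ?thesis by simp
    next
      case 2
      with grows_15 show ?thesis by simp
    next
      case 3
      with strongly_grows_imp_grows[OF strongly_grows_16] show ?thesis by simp
    next
      case 4
      with grows_17 show ?thesis by simp
    next
      case 5
      then show ?thesis by (intro grows_mono[OF grows_18]) auto
    next
      case 6
      then show ?thesis by (intro grows_mono[OF grows_20]) auto
    next
      case 7
      then show ?thesis by (intro grows_mono[OF grows_24]) auto
    qed
  next
    case False
    let ?k = "n div 2"
    \<comment> \<open>Since \<open>n\<close> is at least 28, \<open>?k\<close> is at least 14 and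
      the induction hypothesis applies. For odd \<open>n\<close> one dimension is padded
      afterwards.\<close>
    have "grows (?k * 2) (1.0045 * (real ?k + 1) * 2)"
      using less.IH[of ?k] False by (intro grows_times strongly_grows_2) auto
    moreover have "n \<le> 2 * ?k + 1" by linarith
    then have "real n \<le> 2 * real ?k + 1" by linarith
    ultimately show ?thesis
      using False by (elim grows_mono) auto
  qed
qed

lemma grows_from_11:
  assumes "11 \<le> n"
  shows "grows n (1.0045 * real n)"
proof (cases "14 \<le> n")
  case True
  then show ?thesis by (intro grows_mono[OF grows_from_14[OF True]]) auto
next
  case False
  with assms consider "n = 11" | "n = 12" | "n = 13" by linarith
  then show ?thesis
    by cases (use grows_11 grows_12 grows_mono[OF grows_13, of 13 "13.0585"] in auto)
qed

section \<open>Superlinear growth along the powers of 16\<close>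

lemma grows_power_16: "grows (16 ^ Suc k) (17.0765 ^ Suc k)"
proof (induction k)
  case 0
  then show ?case using strongly_grows_imp_grows[OF strongly_grows_16] by simp
next
  case (Suc k)
  have "grows (16 ^ Suc k * 16) (17.0765 ^ Suc k * 17.0765)"
    by (intro grows_times Suc strongly_grows_16) auto
  then show ?case by (simp only: power_Suc mult.commute)
qed

text \<open>The ratio is at least \<open>(17.0765 / 16) ^ Suc k\<close>, which Bernoulli's
  inequality bounds below linearly in \<open>k\<close>. The threshold 36 suffices because 37 *
  1.0765 / 16 exceeds 2.317.\<close>

lemma gsup_ratio_power_16:
  assumes "36 \<le> k"
  shows "ereal 3.317 \<le> gsup (16 ^ Suc k) (CP (16 ^ Suc k) \<real>) / ereal (real (16 ^ Suc k))"
proof -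
  have "3.317 \<le> 1 + real (Suc k) * (1.0765 / 16)"
    using assms by simp
  also have "\<dots> \<le> (1 + 1.0765 / 16) ^ Suc k"
    by (rule Bernoulli_inequality) simp
  also have "\<dots> = 17.0765 ^ Suc k / 16 ^ Suc k"
    by (simp only: power_divide[symmetric]) simp
  finally have "ereal 3.317 \<le> ereal (17.0765 ^ Suc k) / ereal (real (16 ^ Suc k))"
    by simp
  also have "\<dots> \<le> gsup (16 ^ Suc k) (CP (16 ^ Suc k) \<real>) / ereal (real (16 ^ Suc k))"
    by (intro ereal_divide_right_mono grows_le_gsup grows_power_16) auto
  finally show ?thesis .
qed

theorem theorem1p1:
  shows "(\<forall>n::nat. n > 10 \<longrightarrow> ereal (1.0045 * real n) \<le> gsup n (CP n \<real>))
    \<and> limsup (\<lambda>n::nat. gsup n (CP n \<real>) / ereal (real n)) \<ge> ereal 3.317"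
proof
  show "\<forall>n::nat. n > 10 \<longrightarrow> ereal (1.0045 * real n) \<le> gsup n (CP n \<real>)"
    by (intro allI impI grows_le_gsup grows_from_11) auto
  let ?X = "\<lambda>n::nat. gsup n (CP n \<real>) / ereal (real n)"
  \<comment> \<open>The limsup is at least the limsup along powers of 16, where the bound holds
    eventually.\<close>
  have "strict_mono (\<lambda>k. 16 ^ Suc k :: nat)"
    by (auto simp: strict_mono_Suc_iff)
  then have "limsup (?X \<circ> (\<lambda>k. 16 ^ Suc k)) \<le> limsup ?X"
    by (rule limsup_subseq_mono)
  moreover have "eventually (\<lambda>k. ereal 3.317 \<le> (?X \<circ> (\<lambda>k. 16 ^ Suc k)) k) sequentially"
    unfolding eventually_sequentially comp_def using gsup_ratio_power_16 by blast
  then have "ereal 3.317 \<le> liminf (?X \<circ> (\<lambda>k. 16 ^ Suc k))"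
    by (rule Liminf_bounded)
  moreover have "liminf (?X \<circ> (\<lambda>k. 16 ^ Suc k)) \<le> limsup (?X \<circ> (\<lambda>k. 16 ^ Suc k))"
    by (rule Liminf_le_Limsup) simp
  ultimately show "limsup ?X \<ge> ereal 3.317" by order
qed

end
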